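(* Let $s,y,z$ be indeterminates and define sequences $a_n,b_n,d_n,\alpha_n$ ($n\ge0$) by $$\sum a_nx^n=\frac{(1-yz+z^2)(1-(y^2-2)x+x^2)}{(1-x)(1-(y^2-2)x+x^2)},\quad \sum b_nx^n=\frac{-z+y(yz-1)x-z(yz-1)x^2}{(1-x)(1-(y^2-2)x+x^2)},$$ $$\sum d_nx^n=\frac{-1-(1+z^2-2yz)x-z^2x^2}{(1-x)(1-(y^2-2)x+x^2)},\quad \sum\alpha_nx^n=\frac{1+zx}{1+yx+x^2}.$$ For $n\ge0$ let $f_n(x)$ be the formal power series with constant term $1$ satisfying $$(a_nx^4-sb_nx^3+b_nx^2)f_n(x)^2+\big((yd_n-2b_n)x^2-sd_nx+d_n\big)f_n(x)=d_n.$$ Then for every $n\ge0$, $$f_n(x)=\cfrac{1}{1-sx-\cfrac{\frac{\alpha_{n+1}}{\alpha_n}x^2}{1-\cfrac{\frac{\alpha_n}{\alpha_{n+1}}x^2}{1-sx-\cfrac{\frac{\alpha_{n+2}}{\alpha_{n+1}}x^2}{1-\cfrac{\frac{\alpha_{n+1}}{\alpha_{n+2}}x^2}{\ddots}}}}},$$ i.e. the $J$-fraction with $u_{2j+1}=-s$, $u_{2j+2}=0$, $v_0=1$, $v_{2j+1}=\alpha_{n+j+1}/\alpha_{n+j}$, $v_{2j+2}=\alpha_{n+j}/\alpha_{n+j+1}$ ($j\ge0$).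
   Context: All series are formal power series in $x$ with coefficients rational functions of $s,y,z$. A $J$-fraction with sequences $(u_1,u_2,\dots)$, $(v_0,v_1,\dots)$ is $\cfrac{v_0}{1+u_1x-\cfrac{v_1x^2}{1+u_2x-\cdots}}$. *)

theory Defs
  imports
    "HOL-Computational_Algebra.Formal_Power_Series"
    "HOL-Computational_Algebra.Polynomial_Factorial"
begin

text \<open>
  The field \<open>k(s, y, z)\<close> of rational functions is the fraction field of \<open>k[s][y][z]\<close>,
  over an arbitrary field \<open>k\<close>.
\<close>

type_synonym 'k ratfun3 = "'k poly poly poly fract"

definition ind_s :: "'k::field ratfun3" where
  "ind_s = to_fract [:[:[:0, 1:]:]:]"

definition ind_y :: "'k::field ratfun3" where
  "ind_y = to_fract [:[:0, 1:]:]"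

definition ind_z :: "'k::field ratfun3" where
  "ind_z = to_fract [:0, 1:]"

definition abd_denom :: "'k::field ratfun3 fps" where
  "abd_denom = (let y = ind_y; X = fps_X in
     (1 - X) * (1 - fps_const (y\<^sup>2 - 2) * X + X\<^sup>2))"

definition a_seq :: "nat \<Rightarrow> 'k::field ratfun3" where
  "a_seq n = (let y = ind_y; z = ind_z; X = fps_X in
     fps_nth (fps_const (1 - y * z + z\<^sup>2) * (1 - fps_const (y\<^sup>2 - 2) * X + X\<^sup>2)
              / abd_denom) n)"

definition b_seq :: "nat \<Rightarrow> 'k::field ratfun3" where
  "b_seq n = (let y = ind_y; z = ind_z; X = fps_X in
     fps_nth ((- fps_const z + fps_const (y * (y * z - 1)) * X
                 - fps_const (z * (y * z - 1)) * X\<^sup>2)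
              / abd_denom) n)"

definition d_seq :: "nat \<Rightarrow> 'k::field ratfun3" where
  "d_seq n = (let y = ind_y; z = ind_z; X = fps_X in
     fps_nth ((- 1 - fps_const (1 + z\<^sup>2 - 2 * y * z) * X - fps_const (z\<^sup>2) * X\<^sup>2)
              / abd_denom) n)"

definition alpha_seq :: "nat \<Rightarrow> 'k::field ratfun3" where
  "alpha_seq n = (let y = ind_y; z = ind_z; X = fps_X in
     fps_nth ((1 + fps_const z * X) / (1 + fps_const y * X + X\<^sup>2)) n)"

definition is_f :: "nat \<Rightarrow> 'k::field ratfun3 fps \<Rightarrow> bool" where
  "is_f n f \<longleftrightarrow>
     (let s = ind_s; y = ind_y; X = fps_X; a = a_seq n; b = b_seq n; d = d_seq n in
      fps_nth f 0 = 1 \<and>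
      (fps_const a * X ^ 4 - fps_const (s * b) * X ^ 3 + fps_const b * X\<^sup>2) * f\<^sup>2
      + (fps_const (y * d - 2 * b) * X\<^sup>2 - fps_const (s * d) * X + fps_const d) * f
      = fps_const d)"

definition f_ser :: "nat \<Rightarrow> 'k::field ratfun3 fps" where
  "f_ser n = (THE f. is_f n f)"

text \<open>
  \<open>jfrac_denom u v m k\<close> is the finite continued fraction
  \<open>1 + u\<^sub>k\<^sub>+\<^sub>1 x - v\<^sub>k\<^sub>+\<^sub>1 x\<^sup>2 / (1 + u\<^sub>k\<^sub>+\<^sub>2 x - \<dots> / (1 + u\<^sub>k\<^sub>+\<^sub>m\<^sub>+\<^sub>1 x))\<close>.
  Every denominator has constant term 1, so each division is by a unit. The value \<open>u 0\<close> is not used.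
\<close>

primrec jfrac_denom ::
    "(nat \<Rightarrow> 'a::field) \<Rightarrow> (nat \<Rightarrow> 'a) \<Rightarrow> nat \<Rightarrow> nat \<Rightarrow> 'a fps" where
  "jfrac_denom u v 0 k = 1 + fps_const (u (Suc k)) * fps_X"
| "jfrac_denom u v (Suc m) k =
     1 + fps_const (u (Suc k)) * fps_X
       - fps_const (v (Suc k)) * fps_X\<^sup>2 / jfrac_denom u v m (Suc k)"

definition jfrac_convergent ::
    "(nat \<Rightarrow> 'a::field) \<Rightarrow> (nat \<Rightarrow> 'a) \<Rightarrow> nat \<Rightarrow> 'a fps" where
  "jfrac_convergent u v m = fps_const (v 0) / jfrac_denom u v m 0"

text \<open>
  The infinite fraction is the limit of its convergents in the \<open>x\<close>-adic topology, which is the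
  topology of the library's metric on formal power series.
\<close>

definition has_jfraction ::
    "'a::field fps \<Rightarrow> (nat \<Rightarrow> 'a) \<Rightarrow> (nat \<Rightarrow> 'a) \<Rightarrow> bool" where
  "has_jfraction f u v \<longleftrightarrow> jfrac_convergent u v \<longlonglongrightarrow> f"

end

theory Submission
  imports Defs
begin

text \<open>
  With \<open>q = \<alpha>\<^sub>n\<close> and \<open>r = \<alpha>\<^sub>n\<^sub>+\<^sub>1\<close>, the recurrence of \<open>\<alpha>\<close> gives
  \<open>a\<^sub>n = q\<^sup>2 + y q r + r\<^sup>2\<close>, \<open>b\<^sub>n = - q (y q + r)\<close> and \<open>d\<^sub>n = - q\<^sup>2\<close>. As \<open>d\<^sub>n\<close> is a unit, the
  quadratic equation is a fixed point equation for an \<open>x\<close>-adic contraction, so it has exactly one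
  solution. If \<open>g\<close> solves the equation for \<open>n + 1\<close>, then
  \<open>1 / (1 - s x - (r / q) x\<^sup>2 / (1 - (q / r) x\<^sup>2 g))\<close> solves the one for \<open>n\<close>, because after clearing
  denominators one residual is \<open>q\<^sup>4 x\<^sup>4\<close> times the other. By uniqueness this is \<open>f\<^sub>n\<close>, and iteration
  exhibits complete quotients of the J-fraction, which the finite fractions approximate to
  increasing order.
\<close>

section \<open>Formal power series\<close>

lemma fps_X_power_dvd_imp_nth_eq_0:
  assumes "fps_X ^ m dvd (f :: 'a::comm_ring_1 fps)" "i < m"
  shows "fps_nth f i = 0"
  using assms by (auto simp: dvd_def fps_X_power_mult_nth)

lemma fps_eq_0_if_all_fps_X_power_dvd:
  assumes "\<And>m. fps_X ^ m dvd (f :: 'a::comm_ring_1 fps)"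
  shows "f = 0"
  using assms by (auto intro!: fps_ext fps_X_power_dvd_imp_nth_eq_0)

text \<open>The factor \<open>fps_X\<close> makes the right-hand side a contraction: it raises the
  order of a difference by one. Its iterates therefore converge coefficientwise to a
  solution.\<close>

lemma fps_quadratic_ex1:
  fixes A B :: "'a::field fps"
  shows "\<exists>!f. f = 1 + fps_X * (A * f\<^sup>2 + B * f)"
proof (rule ex_ex1I)
  define \<Phi> where "\<Phi> f = 1 + fps_X * (A * f\<^sup>2 + B * f)" for f
  have contraction: "fps_X ^ Suc m dvd \<Phi> f - \<Phi> g" if "fps_X ^ m dvd f - g" for f g m
  proof -
    have "\<Phi> f - \<Phi> g = fps_X * ((f - g) * (A * (f + g) + B))"
      by (simp add: \<Phi>_def algebra_simps power2_eq_square)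
    then show ?thesis
      using that by (simp add: mult_dvd_mono)
  qed
  define F where "F k = (\<Phi> ^^ k) 0" for k
  \<comment> \<open>The iterates \<open>F k\<close> agree modulo \<open>fps_X ^ Suc n\<close> once
    \<open>k > n\<close>, so the coefficient of index \<open>n\<close> is final from
    \<open>F (Suc n)\<close> on.\<close>
  define f where "f = Abs_fps (\<lambda>n. fps_nth (F (Suc n)) n)"
  have F_Suc: "F (Suc k) = \<Phi> (F k)" for k
    by (simp add: F_def)
  have step: "fps_X ^ k dvd F (Suc k) - F k" for k
    by (induction k) (simp_all only: F_Suc contraction power_0 one_dvd)
  have cauchy: "fps_X ^ k dvd F (k + j) - F k" for k j
  proof (induction j)
    case (Suc j)
    have "fps_X ^ k dvd F (Suc (k + j)) - F (k + j)"
      using step[of "k + j"] unfolding power_add by (rule dvd_mult_left)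
    from dvd_add[OF this Suc] show ?case by simp
  qed simp
  have lim: "fps_X ^ k dvd f - F k" for k
  proof (cases "f - F k = 0")
    case False
    have "fps_nth (f - F k) i = 0" if "i < k" for i
    proof -
      from that obtain j where j: "k = Suc i + j"
        using less_iff_Suc_add by auto
      show ?thesis
        using fps_X_power_dvd_imp_nth_eq_0[OF cauchy[of "Suc i" j], of i]
        by (simp add: f_def j)
    qed
    with False have "k \<le> subdegree (f - F k)"
      by (intro subdegree_geI) auto
    with False show ?thesis by (simp add: fps_dvd_iff)
  qed simp
  have "fps_X ^ k dvd f - \<Phi> f" for k
  proof -
    have 1: "fps_X ^ k dvd f - F (Suc k)"
      using lim[of "Suc k"] by (rule dvd_trans[rotated]) (simp add: le_imp_power_dvd)
    have 2: "fps_X ^ k dvd \<Phi> (F k) - \<Phi> f"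
      using contraction[OF lim[of k]]
      by (metis dvd_minus_iff minus_diff_eq dvd_trans le_imp_power_dvd le_SucI order_refl)
    show ?thesis using dvd_add[OF 1 2] by (simp add: F_Suc)
  qed
  then have "f - \<Phi> f = 0"
    by (rule fps_eq_0_if_all_fps_X_power_dvd)
  then have "f = \<Phi> f"
    by (rule right_minus_eq[THEN iffD1])
  then show "\<exists>f. f = 1 + fps_X * (A * f\<^sup>2 + B * f)"
    unfolding \<Phi>_def by blast
next
  fix f g
  assume fg: "f = 1 + fps_X * (A * f\<^sup>2 + B * f)" "g = 1 + fps_X * (A * g\<^sup>2 + B * g)"
  \<comment> \<open>The difference of the two equations factors as \<open>f - g\<close> times a
    series with constant term 1, which is nonzero.\<close>
  have "(f - g) * (1 - fps_X * (A * (f + g) + B))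
      = (f - (1 + fps_X * (A * f\<^sup>2 + B * f))) - (g - (1 + fps_X * (A * g\<^sup>2 + B * g)))"
    by (simp add: algebra_simps power2_eq_square)
  then have "(f - g) * (1 - fps_X * (A * (f + g) + B)) = 0"
    by (simp only: fg[symmetric] diff_self)
  moreover have "fps_nth (1 - fps_X * (A * (f + g) + B)) 0 = 1"
    by simp
  then have "1 - fps_X * (A * (f + g) + B) \<noteq> 0"
    by (metis fps_zero_nth zero_neq_one)
  ultimately show "f = g" by simp
qed

lemma fps_divide_unit_eqI:
  fixes f g h :: "'a::field fps"
  assumes "h * g = f" "fps_nth g 0 \<noteq> 0"
  shows "f / g = h"
  using assms by (metis fps_nonzeroI nonzero_mult_div_cancel_right)

section \<open>Convergence of J-fractions\<close>

lemma jfrac_denom_nth_0 [simp]: "fps_nth (jfrac_denom u v m k) 0 = 1"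
  by (induction m arbitrary: k) (simp_all add: fps_divide_unit)

text \<open>\<open>D k\<close> plays the role of the complete quotient, the infinite tail starting
  at level \<open>k\<close>. Inverting units keeps the order of a difference, so each level gains
  the factor \<open>fps_X\<^sup>2\<close>; the induction uses only one \<open>fps_X\<close> of
  it.\<close>

lemma fps_X_power_dvd_jfrac_denom_diff:
  fixes D :: "nat \<Rightarrow> 'a::field fps"
  assumes D0: "\<And>k. fps_nth (D k) 0 = 1"
    and D: "\<And>k. D k = 1 + fps_const (u (Suc k)) * fps_X
                     - fps_const (v (Suc k)) * fps_X\<^sup>2 / D (Suc k)"
  shows "fps_X ^ m dvd jfrac_denom u v m k - D k"
proof (induction m arbitrary: k)
  case (Suc m)
  define J where "J = jfrac_denom u v m (Suc k)"
  have J0: "fps_nth J 0 = 1"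
    by (simp add: J_def)
  then have J: "J * inverse J = 1" and DD: "D (Suc k) * inverse (D (Suc k)) = 1"
    by (simp_all add: inverse_mult_eq_1' D0)
  have "jfrac_denom u v (Suc m) k - D k
      = fps_const (v (Suc k)) * fps_X\<^sup>2 * (inverse (D (Suc k)) - inverse J)"
    by (subst D) (simp add: fps_divide_unit D0 J0 right_diff_distrib flip: J_def)
  also have "inverse (D (Suc k)) - inverse J
      = (J - D (Suc k)) * (inverse J * inverse (D (Suc k)))"
    using J DD by algebra
  also have "fps_const (v (Suc k)) * fps_X\<^sup>2 * \<dots>
      = (fps_X * (J - D (Suc k)))
        * (fps_const (v (Suc k)) * fps_X * (inverse J * inverse (D (Suc k))))"
    by (simp add: power2_eq_square mult_ac)
  finally show ?case
    using Suc[of "Suc k"] by (simp add: mult_dvd_mono flip: J_def)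
qed simp

lemma has_jfraction_if_complete_quotients:
  fixes D :: "nat \<Rightarrow> 'a::field fps"
  assumes D0: "\<And>k. fps_nth (D k) 0 = 1"
    and D: "\<And>k. D k = 1 + fps_const (u (Suc k)) * fps_X
                     - fps_const (v (Suc k)) * fps_X\<^sup>2 / D (Suc k)"
  shows "has_jfraction (fps_const (v 0) / D 0) u v"
proof -
  have "(\<lambda>m. jfrac_denom u v m 0) \<longlonglongrightarrow> D 0"
  proof (rule tendsto_fpsI)
    fix i
    show "eventually (\<lambda>m. fps_nth (jfrac_denom u v m 0) i = fps_nth (D 0) i) sequentially"
      using eventually_gt_at_top[of i]
    proof eventually_elim
      case (elim m)
      have "fps_X ^ m dvd jfrac_denom u v m 0 - D 0"
        using D0 D by (rule fps_X_power_dvd_jfrac_denom_diff)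
      from fps_X_power_dvd_imp_nth_eq_0[OF this elim] show ?case by simp
    qed
  qed
  then have "(\<lambda>m. inverse (jfrac_denom u v m 0)) \<longlonglongrightarrow> inverse (D 0)"
    by (rule tendsto_inverse_fps) (simp add: D0)
  then have "(\<lambda>m. fps_const (v 0) * inverse (jfrac_denom u v m 0))
               \<longlonglongrightarrow> fps_const (v 0) * inverse (D 0)"
    unfolding tendsto_fps_iff by (auto elim: eventually_mono)
  then show ?thesis
    by (simp add: has_jfraction_def jfrac_convergent_def[abs_def] fps_divide_unit D0)
qed

section \<open>The quadratic equation\<close>

text \<open>The equation for \<open>f\<close> with its coefficients written in two consecutive
  values \<open>q\<close>, \<open>r\<close> of \<open>alpha_seq\<close>. All arguments lie in one
  ring, so that the passage between indices becomes a polynomial identity.\<close>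

definition quad_residual :: "'a::comm_ring_1 \<Rightarrow> 'a \<Rightarrow> 'a \<Rightarrow> 'a \<Rightarrow> 'a \<Rightarrow> 'a \<Rightarrow> 'a" where
  "quad_residual x s y q r f =
     ((q\<^sup>2 + y * q * r + r\<^sup>2) * x ^ 4 + s * (q * (y * q + r)) * x ^ 3 - q * (y * q + r) * x\<^sup>2) * f\<^sup>2
     + ((y * q\<^sup>2 + 2 * q * r) * x\<^sup>2 + s * q\<^sup>2 * x - q\<^sup>2) * f + q\<^sup>2"

lemma quad_residual_eq_0_iff:
  assumes "a = q\<^sup>2 + y * q * r + r\<^sup>2" "b = - q * (y * q + r)" "d = - q\<^sup>2"
  shows "quad_residual x s y q r f = 0 \<longleftrightarrow>
    (a * x ^ 4 - s * b * x ^ 3 + b * x\<^sup>2) * f\<^sup>2 + ((y * d - 2 * b) * x\<^sup>2 - s * d * x + d) * f = d"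
proof -
  have "quad_residual x s y q r f
      = (a * x ^ 4 - s * b * x ^ 3 + b * x\<^sup>2) * f\<^sup>2 + ((y * d - 2 * b) * x\<^sup>2 - s * d * x + d) * f - d"
    unfolding assms quad_residual_def by (simp add: algebra_simps power2_eq_square)
  then show ?thesis by simp
qed

text \<open>The map from \<open>(q, r)\<close> to \<open>(r, - y * r - q)\<close> is the index shift
  of \<open>alpha_seq\<close>. Clearing denominators in the two-level fraction with tail
  \<open>g\<close> gives \<open>f = q * h / m\<close>; \<open>mf\<close> states this without
  division.\<close>

lemma quad_residual_step:
  fixes x :: "'a::idom"
  assumes "h = r - q * x\<^sup>2 * g"
    and "m = q * h * (1 - s * x) - r\<^sup>2 * x\<^sup>2"
    and mf: "m * f = q * h"
  shows "m\<^sup>2 * quad_residual x s y q r f = q ^ 4 * x ^ 4 * quad_residual x s y r (- y * r - q) g"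
proof -
  have "m\<^sup>2 * quad_residual x s y q r f =
     ((q\<^sup>2 + y * q * r + r\<^sup>2) * x ^ 4 + s * (q * (y * q + r)) * x ^ 3 - q * (y * q + r) * x\<^sup>2)
       * (m * f)\<^sup>2
     + ((y * q\<^sup>2 + 2 * q * r) * x\<^sup>2 + s * q\<^sup>2 * x - q\<^sup>2) * (m * f) * m + q\<^sup>2 * m\<^sup>2"
    unfolding quad_residual_def by algebra
  also have "\<dots> = q ^ 4 * x ^ 4 * quad_residual x s y r (- y * r - q) g"
    unfolding mf unfolding assms(1,2) quad_residual_def by algebra
  finally show ?thesis .
qed

lemma quad_residual_continued_fraction:
  fixes g :: "'a::field fps"
  defines "C \<equiv> fps_const"
  assumes g: "quad_residual fps_X (C s) (C y) (C r) (C (- y * r - q)) g = 0"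
    and q: "q \<noteq> 0" and r: "r \<noteq> 0"
    and f: "f = 1 / (1 - C s * fps_X - C (r / q) * fps_X\<^sup>2 / (1 - C (q / r) * fps_X\<^sup>2 * g))"
  shows "quad_residual fps_X (C s) (C y) (C q) (C r) f = 0"
proof -
  define k where "k = 1 - C (q / r) * fps_X\<^sup>2 * g"
  define h where "h = C r - C q * fps_X\<^sup>2 * g"
  define m where "m = C q * h * (1 - C s * fps_X) - (C r)\<^sup>2 * fps_X\<^sup>2"
  define d where "d = 1 - C s * fps_X - C (r / q) * fps_X\<^sup>2 / k"
  have k0: "fps_nth k 0 = 1"
    by (simp add: k_def mult.assoc)
  have h: "h = C r * k" and cq: "C (r / q) * C q = C r"
    using q r by (simp_all add: h_def k_def C_def right_diff_distrib flip: mult.assoc)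
  have "C q * h * d = C q * h * (1 - C s * fps_X) - C r * (C (r / q) * C q) * (fps_X\<^sup>2 * (inverse k * k))"
    by (simp add: d_def fps_divide_unit k0 h algebra_simps)
  \<comment> \<open>With \<open>m = C q * h * d\<close> and \<open>f * d = 1\<close>, the cleared
    relation follows, and the constant term of \<open>m\<close> is \<open>q * r\<close>, so
    \<open>m\<close> can be cancelled.\<close>
  then have m: "m = C q * h * d"
    using k0 by (simp add: m_def cq inverse_mult_eq_1 power2_eq_square)
  have d0: "fps_nth d 0 = 1"
    by (simp add: d_def fps_divide_unit k0 mult.assoc)
  have "f * d = 1"
    using d0 by (simp add: f d_def[symmetric] k_def[symmetric] fps_divide_unit inverse_mult_eq_1)
  then have "m * f = C q * h"
    unfolding m by (simp add: mult_ac)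
  from quad_residual_step[OF h_def m_def this, of "C y"] g
  have "m\<^sup>2 * quad_residual fps_X (C s) (C y) (C q) (C r) f = 0"
    by (simp add: C_def flip: fps_const_mult fps_const_sub fps_const_neg)
  moreover have "fps_nth m 0 \<noteq> 0"
    using q r k0 d0 by (simp add: m h C_def mult.assoc)
  then have "m \<noteq> 0" by auto
  ultimately show ?thesis by simp
qed

lemma quad_residual_ex1:
  fixes q :: "'a::field"
  assumes q: "q \<noteq> 0"
  shows "\<exists>!f. fps_nth f 0 = 1 \<and>
           quad_residual fps_X (fps_const s) (fps_const y) (fps_const q) (fps_const r) f = 0"
proof -
  define c where "c = fps_const q"
  define i where "i = (fps_const (inverse q))\<^sup>2"
  define R where "R = quad_residual fps_X (fps_const s) (fps_const y) c (fps_const r)"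
  \<comment> \<open>Dividing the residual by \<open>q\<^sup>2\<close> isolates \<open>1 - f\<close>.
    Every other term contains \<open>fps_X\<close>, and \<open>A\<close>, \<open>B\<close> are what
    remains of the coefficients after this factor is taken out.\<close>
  define A where "A = i * ((c\<^sup>2 + fps_const y * c * fps_const r + (fps_const r)\<^sup>2) * fps_X ^ 3
     + fps_const s * (c * (fps_const y * c + fps_const r)) * fps_X\<^sup>2
     - c * (fps_const y * c + fps_const r) * fps_X)"
  define B where "B = i * ((fps_const y * c\<^sup>2 + 2 * c * fps_const r) * fps_X + fps_const s * c\<^sup>2)"
  have ci: "i * c\<^sup>2 = 1"
    using q by (simp add: i_def c_def flip: power_mult_distrib)
  have "i * R f = 1 + fps_X * (A * f\<^sup>2 + B * f) - f" for f
    using ci unfolding R_def A_def B_def quad_residual_def by algebra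
  moreover have "i \<noteq> 0"
    using ci by auto
  ultimately have *: "R f = 0 \<longleftrightarrow> f = 1 + fps_X * (A * f\<^sup>2 + B * f)" for f
    by (metis eq_iff_diff_eq_0 mult_eq_0_iff)
  have "fps_nth f 0 = 1" if "f = 1 + fps_X * (A * f\<^sup>2 + B * f)" for f
    by (subst that) simp
  then have "fps_nth f 0 = 1 \<and> R f = 0 \<longleftrightarrow> f = 1 + fps_X * (A * f\<^sup>2 + B * f)" for f
    using * by blast
  then show ?thesis
    using fps_quadratic_ex1[of A B] by (simp add: R_def c_def)
qed

section \<open>The coefficient sequences\<close>

lemma alpha_seq_0: "alpha_seq 0 = 1"
  and alpha_seq_1: "alpha_seq (Suc 0) = ind_z - ind_y"
  and alpha_seq_Suc_Suc: "alpha_seq (Suc (Suc n)) = - ind_y * alpha_seq (Suc n) - alpha_seq n"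
proof -
  define A :: "'k::field ratfun3 fps" where "A = Abs_fps alpha_seq"
  define D :: "'k ratfun3 fps" where "D = 1 + fps_const ind_y * fps_X + fps_X\<^sup>2"
  have "D dvd 1 + fps_const ind_z * fps_X"
    by (rule fps_unit_dvd) (simp add: D_def)
  moreover have "A = (1 + fps_const ind_z * fps_X) / D"
    by (rule fps_ext) (simp add: A_def alpha_seq_def Let_def D_def)
  ultimately have "A * D = 1 + fps_const ind_z * fps_X"
    by (simp only: dvd_div_mult_self)
  then have AD: "A + fps_const ind_y * (fps_X * A) + fps_X * (fps_X * A) = 1 + fps_const ind_z * fps_X"
    by (simp add: D_def algebra_simps power2_eq_square)
  show "alpha_seq 0 = (1 :: 'k ratfun3)"
    using arg_cong[OF AD, of "\<lambda>f. fps_nth f 0"] by (simp add: A_def)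
  then show "alpha_seq (Suc 0) = (ind_z - ind_y :: 'k ratfun3)"
    using arg_cong[OF AD, of "\<lambda>f. fps_nth f (Suc 0)"] by (simp add: A_def algebra_simps)
  show "alpha_seq (Suc (Suc n)) = - ind_y * alpha_seq (Suc n) - (alpha_seq n :: 'k ratfun3)"
    using arg_cong[OF AD, of "\<lambda>f. fps_nth f (Suc (Suc n))"]
    by (simp add: A_def algebra_simps eq_neg_iff_add_eq_0)
qed

lemmas alpha_seq_rec = alpha_seq_0 alpha_seq_1 alpha_seq_Suc_Suc

text \<open>At \<open>z = 0\<close>, \<open>\<alpha>\<^sub>n\<close> is a polynomial in \<open>y\<close> with leading term \<open>(-y)\<^sup>n\<close>.\<close>

lemma alpha_seq_neq_0: "alpha_seq n \<noteq> (0 :: 'k::field ratfun3)"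
proof -
  \<comment> \<open>The outermost variable is \<open>z\<close>, so \<open>coeff p 0\<close> is the
    value at \<open>z = 0\<close>, a polynomial in \<open>y\<close>. Two consecutive indices are
    carried for the recurrence; the degree bound on \<open>p\<close> keeps it out of the new top
    coefficient.\<close>
  have "\<exists>p q. alpha_seq n = (to_fract p :: 'k ratfun3) \<and> alpha_seq (Suc n) = (to_fract q :: 'k ratfun3)
      \<and> degree (coeff p 0) \<le> n \<and> degree (coeff q 0) \<le> Suc n
      \<and> coeff (coeff p 0) n \<noteq> 0 \<and> coeff (coeff q 0) (Suc n) \<noteq> 0"
  proof (induction n)
    case 0
    show ?case
      by (rule exI[of _ 1], rule exI[of _ "[:0, 1:] - [:[:0, 1:]:]"])
        (simp add: alpha_seq_rec ind_y_def ind_z_def del: diff_pCons)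
  next
    case (Suc n)
    then obtain p q :: "'k poly poly poly" where pq: "alpha_seq n = to_fract p"
        "alpha_seq (Suc n) = to_fract q" "degree (coeff p 0) \<le> n" "degree (coeff q 0) \<le> Suc n"
        "coeff (coeff q 0) (Suc n) \<noteq> 0"
      by blast
    define t where "t = - [:[:0, 1:]:] * q - p"
    have t0: "coeff t 0 = - pCons 0 (coeff q 0) - coeff p 0"
      by (simp add: t_def)
    have "degree (coeff t 0) \<le> Suc (Suc n)"
      unfolding t0 using pq(3,4)
      by (intro degree_diff_le) auto
    moreover have "coeff (coeff t 0) (Suc (Suc n)) \<noteq> 0"
      using pq(3,5) by (simp add: t0 coeff_eq_0)
    moreover have "alpha_seq (Suc (Suc n)) = (to_fract t :: 'k ratfun3)"
      by (simp only: alpha_seq_Suc_Suc pq t_def ind_y_def to_fract_diff to_fract_mult to_fract_uminus)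
    ultimately show ?case
      using pq by blast
  qed
  then show ?thesis
    by (metis coeff_0 to_fract_eq_0_iff)
qed

text \<open>The quadratic form is preserved by the shift from \<open>(q, r)\<close> to
  \<open>(r, - y * r - q)\<close>, hence keeps its initial value.\<close>

lemma alpha_seq_invariant:
  "(alpha_seq n)\<^sup>2 + ind_y * alpha_seq n * alpha_seq (Suc n) + (alpha_seq (Suc n))\<^sup>2
     = (1 - ind_y * ind_z + ind_z\<^sup>2 :: 'k::field ratfun3)"
proof (induction n)
  case 0
  show ?case by (simp add: alpha_seq_rec algebra_simps power2_eq_square)
next
  case (Suc n)
  then show ?case unfolding alpha_seq_Suc_Suc by algebra
qed

section \<open>Closed forms of the coefficients of the equation\<close>

lemma abd_denom_nth_0: "fps_nth abd_denom 0 = 1"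
  by (simp add: abd_denom_def Let_def)

text \<open>Nested shifts by \<open>fps_X\<close> let the simplifier read off coefficients.\<close>

lemma mult_abd_denom:
  "f * abd_denom = f - fps_const (ind_y\<^sup>2 - 1) * (fps_X * f)
     + fps_const (ind_y\<^sup>2 - 1) * (fps_X * (fps_X * f)) - fps_X * (fps_X * (fps_X * f))"
  for f :: "'k::field ratfun3 fps"
proof -
  have "ind_y\<^sup>2 - 1 = ind_y\<^sup>2 - 2 + (1 :: 'k ratfun3)"
    by simp
  then have "fps_const (ind_y\<^sup>2 - 1) = fps_const (ind_y\<^sup>2 - 2) + (1 :: 'k ratfun3 fps)"
    by (metis fps_const_1_eq_1 fps_const_add)
  then show ?thesis
    unfolding abd_denom_def Let_def by algebra
qed

lemma a_seq_eq:
  "a_seq n = (alpha_seq n)\<^sup>2 + ind_y * alpha_seq n * alpha_seq (Suc n) + (alpha_seq (Suc n))\<^sup>2"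
proof -
  define c :: "'a ratfun3" where "c = 1 - ind_y * ind_z + ind_z\<^sup>2"
  have "Abs_fps (\<lambda>_. c) * (1 - fps_X) = fps_const c"
  proof (rule fps_ext)
    fix k show "fps_nth (Abs_fps (\<lambda>_. c) * (1 - fps_X)) k = fps_nth (fps_const c) k"
      by (simp add: right_diff_distrib)
  qed
  then have "Abs_fps (\<lambda>_. c) * abd_denom
      = fps_const c * (1 - fps_const (ind_y\<^sup>2 - 2) * fps_X + fps_X\<^sup>2)"
    by (simp add: abd_denom_def Let_def flip: mult.assoc)
  then have "fps_const c * (1 - fps_const (ind_y\<^sup>2 - 2) * fps_X + fps_X\<^sup>2) / abd_denom
      = Abs_fps (\<lambda>_. c)"
    by (rule fps_divide_unit_eqI) (simp add: abd_denom_nth_0)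
  then show ?thesis
    unfolding alpha_seq_invariant by (simp add: a_seq_def Let_def c_def)
qed

text \<open>If \<open>t\<^sup>2 + y * t + 1\<close> has roots \<open>l\<close> and
  \<open>1 / l\<close>, quadratic expressions in \<open>alpha_seq\<close> are combinations of powers
  of \<open>l\<^sup>2\<close>, \<open>1\<close> and \<open>1 / l\<^sup>2\<close>. These are the
  reciprocal roots of \<open>abd_denom\<close>, so only the first three coefficients depend on the
  initial values.\<close>

lemma b_seq_eq:
  "b_seq n = (- alpha_seq n * (ind_y * alpha_seq n + alpha_seq (Suc n)) :: 'k::field ratfun3)"
proof -
  define F :: "'k ratfun3 fps" where
    "F = Abs_fps (\<lambda>n. - alpha_seq n * (ind_y * alpha_seq n + alpha_seq (Suc n)))"
  define N :: "'k ratfun3 fps" where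
    "N = - fps_const ind_z + fps_const (ind_y * (ind_y * ind_z - 1)) * fps_X
           - fps_const (ind_z * (ind_y * ind_z - 1)) * fps_X\<^sup>2"
  have "fps_nth (F * abd_denom) k = fps_nth N k" for k
  proof -
    consider "k = 0" | "k = Suc 0" | "k = Suc (Suc 0)" | j where "k = Suc (Suc (Suc j))"
      by (metis not0_implies_Suc)
    then show ?thesis
    proof cases
      \<comment> \<open>Beyond degree 2 the numerator vanishes, and the claim is the third-order
        recurrence, reduced to an identity in two consecutive values of
        \<open>alpha_seq\<close>.\<close>
      case 4
      show ?thesis
        unfolding mult_abd_denom 4 N_def F_def
        by (simp add: alpha_seq_rec(3) power2_eq_square) algebra
    qed (unfold mult_abd_denom, simp_all add: F_def N_def alpha_seq_rec algebra_simps power2_eq_square)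
  qed
  then have "F * abd_denom = N"
    by (rule fps_ext)
  then have "N / abd_denom = F"
    by (rule fps_divide_unit_eqI) (simp add: abd_denom_nth_0)
  then show ?thesis
    by (simp add: b_seq_def Let_def N_def F_def)
qed

lemma d_seq_eq: "d_seq n = (- (alpha_seq n)\<^sup>2 :: 'k::field ratfun3)"
proof -
  define F :: "'k ratfun3 fps" where "F = Abs_fps (\<lambda>n. - (alpha_seq n)\<^sup>2)"
  define N :: "'k ratfun3 fps" where
    "N = - 1 - fps_const (1 + ind_z\<^sup>2 - 2 * ind_y * ind_z) * fps_X - fps_const (ind_z\<^sup>2) * fps_X\<^sup>2"
  have "fps_nth (F * abd_denom) k = fps_nth N k" for k
  proof -
    consider "k = 0" | "k = Suc 0" | "k = Suc (Suc 0)" | j where "k = Suc (Suc (Suc j))"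
      by (metis not0_implies_Suc)
    then show ?thesis
    proof cases
      case 4
      show ?thesis
        unfolding mult_abd_denom 4 N_def F_def
        by (simp add: alpha_seq_rec(3) power2_eq_square) algebra
    qed (unfold mult_abd_denom, simp_all add: F_def N_def alpha_seq_rec algebra_simps power2_eq_square)
  qed
  then have "F * abd_denom = N"
    by (rule fps_ext)
  then have "N / abd_denom = F"
    by (rule fps_divide_unit_eqI) (simp add: abd_denom_nth_0)
  then show ?thesis
    by (simp add: d_seq_def Let_def N_def F_def)
qed

section \<open>Assembly of the J-fraction\<close>

lemma is_f_iff_quad_residual:
  "is_f n f \<longleftrightarrow> fps_nth f 0 = 1 \<and>
     quad_residual fps_X (fps_const ind_s) (fps_const ind_y)
       (fps_const (alpha_seq n)) (fps_const (alpha_seq (Suc n))) f = 0"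
proof -
  define q r :: "'a ratfun3" where "q = alpha_seq n" and "r = alpha_seq (Suc n)"
  have two: "2 * fps_const c = fps_const (2 * c)" for c :: "'a ratfun3"
    by (simp only: mult_2 fps_const_add)
  have eq: "fps_const (a_seq n) = (fps_const q)\<^sup>2 + fps_const ind_y * fps_const q * fps_const r + (fps_const r)\<^sup>2"
    "fps_const (b_seq n) = - fps_const q * (fps_const ind_y * fps_const q + fps_const r)"
    "fps_const (d_seq n) = - (fps_const q)\<^sup>2"
    "fps_const (ind_s * b_seq n) = fps_const ind_s * fps_const (b_seq n :: 'a ratfun3)"
    "fps_const (ind_s * d_seq n) = fps_const ind_s * fps_const (d_seq n :: 'a ratfun3)"
    by (simp_all add: a_seq_eq b_seq_eq d_seq_eq q_def r_def)
  have eq': "fps_const (ind_y * d_seq n - 2 * b_seq n)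
      = fps_const ind_y * fps_const (d_seq n) - 2 * fps_const (b_seq n :: 'a ratfun3)"
    by (simp only: two fps_const_mult fps_const_sub)
  show ?thesis
    unfolding is_f_def Let_def eq'
    using quad_residual_eq_0_iff[OF eq(1-3), of "fps_X" "fps_const ind_s" f]
    by (simp only: eq(4,5) q_def r_def)
qed

theorem theorem3p4:
  fixes n :: nat and u v :: "nat \<Rightarrow> 'k::field ratfun3"
  assumes "\<And>j. u (2 * j + 1) = - ind_s"
    and "\<And>j. u (2 * j + 2) = 0"
    and "v 0 = 1"
    and "\<And>j. v (2 * j + 1) = alpha_seq (n + j + 1) / alpha_seq (n + j)"
    and "\<And>j. v (2 * j + 2) = alpha_seq (n + j) / alpha_seq (n + j + 1)"
  shows "(\<exists>!f :: 'k ratfun3 fps. is_f n f) \<and> has_jfraction (f_ser n :: 'k ratfun3 fps) u v"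
proof -
  have ex1: "\<exists>!f :: 'k ratfun3 fps. is_f k f" for k
    unfolding is_f_iff_quad_residual by (rule quad_residual_ex1[OF alpha_seq_neq_0])
  have f_ser: "is_f k (f_ser k :: 'k ratfun3 fps)" for k
    unfolding f_ser_def by (rule theI'[OF ex1])
  define F :: "nat \<Rightarrow> 'k ratfun3 fps" where "F k = f_ser k" for k
  define E where "E k = 1 - fps_const (alpha_seq k / alpha_seq (Suc k)) * fps_X\<^sup>2 * F (Suc k)" for k
  define G where
    "G k = 1 - fps_const ind_s * fps_X - fps_const (alpha_seq (Suc k) / alpha_seq k) * fps_X\<^sup>2 / E k" for k
  have E0: "fps_nth (E k) 0 = 1" for k
    by (simp add: E_def mult.assoc)
  have G0: "fps_nth (G k) 0 = 1" for k
    by (simp add: G_def E0 fps_divide_unit mult.assoc)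
  \<comment> \<open>\<open>1 / G k\<close> is built from the solution at index \<open>Suc k\<close>
    and solves the equation at index \<open>k\<close>, so uniqueness identifies it with
    \<open>F k\<close>.\<close>
  have FG: "F k = 1 / G k" for k
  proof -
    have "quad_residual fps_X (fps_const ind_s) (fps_const ind_y) (fps_const (alpha_seq (Suc k)))
        (fps_const (- ind_y * alpha_seq (Suc k) - alpha_seq k)) (F (Suc k)) = 0"
      using f_ser[of "Suc k"] unfolding is_f_iff_quad_residual alpha_seq_Suc_Suc F_def by blast
    then have "quad_residual fps_X (fps_const ind_s) (fps_const ind_y)
       (fps_const (alpha_seq k)) (fps_const (alpha_seq (Suc k))) (1 / G k) = 0"
      unfolding G_def E_def
      by (rule quad_residual_continued_fraction[OF _ alpha_seq_neq_0 alpha_seq_neq_0 refl])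
    moreover have "fps_nth (1 / G k) 0 = 1"
      by (simp add: G0 fps_divide_unit)
    ultimately have "is_f k (1 / G k)"
      by (simp add: is_f_iff_quad_residual)
    then show ?thesis
      using ex1 f_ser unfolding F_def by blast
  qed
  \<comment> \<open>One step of the \<open>alpha_seq\<close> index takes two levels:
    \<open>G\<close> supplies the levels with linear term \<open>- ind_s\<close>, \<open>E\<close>
    those without.\<close>
  define D where "D k = (if even k then G (n + k div 2) else E (n + k div 2))" for k
  have "has_jfraction (fps_const (v 0) / D 0) u v"
  proof (rule has_jfraction_if_complete_quotients)
    show "fps_nth (D k) 0 = 1" for k
      by (simp add: D_def E0 G0)
    show "D k = 1 + fps_const (u (Suc k)) * fps_X - fps_const (v (Suc k)) * fps_X\<^sup>2 / D (Suc k)" for k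
    proof (cases "even k")
      case True
      then obtain j where "k = 2 * j" by blast
      then show ?thesis
        using assms(1,4)[of j] by (simp add: D_def G_def flip: fps_const_neg)
    next
      case False
      \<comment> \<open>Here \<open>D (Suc k)\<close> is \<open>G (n + j + 1)\<close>, and
        \<open>FG\<close> turns its reciprocal into the factor \<open>F\<close> inside
        \<open>E\<close>.\<close>
      then obtain j where "k = 2 * j + 1" by (rule oddE)
      then show ?thesis
        using assms(2,5)[of j] by (simp add: D_def E_def FG G0 fps_divide_unit)
    qed
  qed
  moreover have "fps_const (v 0) / D 0 = f_ser n"
    using FG[of n] by (simp add: D_def assms(3) F_def)
  ultimately show ?thesis
    using ex1 by simp
qed

end
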